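(* Let $0<\lambda\le1$ and let $f(z)=z+\sum_{n\ge2}a_nz^n\in\mathcal{ST}_{ss}(\lambda)$. Then for every real number $\delta$ the following sharp inequalities hold: $$|a_3-\delta a_2^2|\le\begin{cases}-\lambda^2\left(\delta+\dfrac{1-3\lambda}{4\lambda}\right) & \text{for } \delta<\dfrac{3(\lambda-1)}{4\lambda},\\[1ex] \dfrac{\lambda}{2} & \text{for } \dfrac{3(\lambda-1)}{4\lambda}\le\delta\le\dfrac{1+3\lambda}{4\lambda},\\[1ex] \lambda^2\left(\delta+\dfrac{1-3\lambda}{4\lambda}\right) & \text{for } \delta>\dfrac{1+3\lambda}{4\lambda}.\end{cases}$$
   Context: $\mathbb{D}=\{z\in\mathbb{C}:|z|<1\}$. $\mathcal{A}$ is the class of holomorphic functions in $\mathbb{D}$ of the form $f(z)=z+\sum_{n\ge 2}a_nz^n$. $\mathcal{ST}$ is the class of univalent $f\in\mathcal{A}$ with $\Re\{zf'(z)/f(z)\}>0$ in $\mathbb{D}$. For $0<\lambda\le1$, $\mathcal{ST}_{ss}(\lambda)$ is the subfamily of $f\in\mathcal{ST}$ satisfying $zf'(z)/f(z)\prec(1+z)^\lambda$ in $\mathbb{D}$, where the branch of the power equals $1$ at $z=0$ and $p\prec q$ (subordination) means $p=q\circ\omega$ for some analytic $\omega:\mathbb{D}\to\mathbb{D}$ with $\omega(0)=0$. "Sharp" means that, for given $\lambda$ and $\delta$, the bound cannot be replaced by a smaller one for the class considered. *)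

theory Defs
  imports "HOL-Complex_Analysis.Complex_Analysis"
begin

abbreviation unit_disc :: "complex set" where
  "unit_disc \<equiv> ball 0 1"

text \<open>Only the values \<open>a n\<close> for \<open>n \<ge> 2\<close> matter; they are uniquely determined by \<open>f\<close>.\<close>

definition normalized_expansion :: "(complex \<Rightarrow> complex) \<Rightarrow> (nat \<Rightarrow> complex) \<Rightarrow> bool" where
  "normalized_expansion f a \<longleftrightarrow>
     (\<forall>z\<in>unit_disc. (\<lambda>n. a (n + 2) * z ^ (n + 2)) sums (f z - z))"

definition class_A :: "(complex \<Rightarrow> complex) set" where
  "class_A = {f. f holomorphic_on unit_disc \<and> (\<exists>a. normalized_expansion f a)}"

text \<open>
  The function \<open>z f'(z) / f(z)\<close> has a removable singularity at the origin, where its value is 1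
  for a normalized \<open>f\<close>; the HOL convention \<open>0 / 0 = 0\<close> would give the wrong value there.
\<close>

definition starlike_quotient :: "(complex \<Rightarrow> complex) \<Rightarrow> complex \<Rightarrow> complex" where
  "starlike_quotient f z = (if z = 0 then 1 else z * deriv f z / f z)"

definition class_ST :: "(complex \<Rightarrow> complex) set" where
  "class_ST = {f \<in> class_A. inj_on f unit_disc \<and>
                 (\<forall>z\<in>unit_disc. Re (starlike_quotient f z) > 0)}"

definition subordinate :: "(complex \<Rightarrow> complex) \<Rightarrow> (complex \<Rightarrow> complex) \<Rightarrow> bool" where
  "subordinate p q \<longleftrightarrow>
     (\<exists>\<omega>. \<omega> holomorphic_on unit_disc \<and> \<omega> ` unit_disc \<subseteq> unit_disc \<and> \<omega> 0 = 0 \<and>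
          (\<forall>z\<in>unit_disc. p z = q (\<omega> z)))"

text \<open>
  On the unit disc \<open>1 + z\<close> lies in the right half-plane, so the principal power is
  the holomorphic branch with value 1 at the origin.
\<close>

definition class_ST_ss :: "real \<Rightarrow> (complex \<Rightarrow> complex) set" where
  "class_ST_ss l = {f \<in> class_ST.
     subordinate (starlike_quotient f) (\<lambda>z. (1 + z) powr complex_of_real l)}"

end

theory Submission
  imports Defs
begin

text \<open>
  The condition \<open>f \<in> \<S>\<T>\<^sub>s\<^sub>s(\<lambda>)\<close> says \<open>z f' = f (1 + \<omega>)\<^sup>\<lambda>\<close> for a Schwarz function
  \<open>\<omega>(z) = c\<^sub>1 z + c\<^sub>2 z\<^sup>2 + \<dots>\<close>. Comparing coefficients gives \<open>a\<^sub>2 = \<lambda> c\<^sub>1\<close> and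
  \<open>a\<^sub>3 = (\<lambda>/2) (c\<^sub>2 + (3\<lambda> - 1)/2 c\<^sub>1\<^sup>2)\<close>, so that
  \<open>a\<^sub>3 - \<delta> a\<^sub>2\<^sup>2 = (\<lambda>/2) (c\<^sub>2 - \<mu> c\<^sub>1\<^sup>2)\<close> with \<open>\<mu> = 2\<lambda>\<delta> - (3\<lambda> - 1)/2\<close>
  (lemma \<open>fekete_szego_functional\<close>). The Schwarz-Pick inequality at the origin, applied to
  \<open>\<omega>(z)/z\<close>, gives \<open>|c\<^sub>2| \<le> 1 - |c\<^sub>1|\<^sup>2\<close>, and therefore \<open>|c\<^sub>2 - \<mu> c\<^sub>1\<^sup>2| \<le> max 1 |\<mu>|\<close>
  (lemma \<open>schwarz_function_fekete_szego\<close>). The three ranges of \<open>\<delta>\<close> in the theorem are \<open>\<mu> < -1\<close>,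
  \<open>-1 \<le> \<mu> \<le> 1\<close> and \<open>\<mu> > 1\<close>, and the bound is \<open>(\<lambda>/2) max 1 |\<mu>|\<close> throughout.

  For sharpness, \<open>\<omega>(z) = z\<close> yields \<open>|c\<^sub>2 - \<mu> c\<^sub>1\<^sup>2| = |\<mu>|\<close> and \<open>\<omega>(z) = z\<^sup>2\<close> yields \<open>1\<close>. These Schwarz
  functions do come from members of the class: for any \<open>\<omega>\<close>, a primitive \<open>g\<close> of
  \<open>((1 + \<omega>)\<^sup>\<lambda> - 1)/z\<close> gives \<open>f(z) = z exp (g z)\<close> with the right quotient
  (lemma \<open>exists_ST_ss_of_schwarz_function\<close>). The point that needs an argument is the univalence of
  \<open>f\<close>. In the logarithmic coordinate \<open>z = exp w\<close> the function \<open>log f\<close> becomes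
  \<open>F(w) = w + g(exp w)\<close> on the left half-plane, whose derivative is the quotient \<open>z f'/f\<close> and has
  positive real part; on a convex domain such a function is injective
  (lemmas \<open>inj_on_if_Re_deriv_pos\<close> and \<open>starlike_imp_univalent\<close>).
\<close>

section \<open>Coefficients of Schwarz functions\<close>

text \<open>
  A Moebius transformation of the disc moves \<open>h 0\<close> to the origin, where the Schwarz lemma bounds
  the derivative; its own derivative at \<open>h 0\<close> is \<open>1 / (1 - |h 0|\<^sup>2)\<close>.
\<close>

lemma schwarz_pick_at_zero:
  assumes h: "h holomorphic_on ball 0 1"
    and lt: "\<And>z. cmod z < 1 \<Longrightarrow> cmod (h z) < 1"
  shows "cmod (deriv h 0) \<le> 1 - (cmod (h 0))\<^sup>2"
proof -
  define b where "b = h 0"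
  have b: "cmod b < 1"
    using lt[of 0] by (simp add: b_def)
  have b2: "(cmod b)\<^sup>2 < 1"
    using b by (simp add: power_less_one_iff)
  define \<psi> where "\<psi> = Moebius_function 0 b \<circ> h"
  have hol: "\<psi> holomorphic_on ball 0 1"
    unfolding \<psi>_def using lt
    by (intro holomorphic_on_compose_gen[OF h Moebius_function_holomorphic[OF b]]) auto
  have \<psi>_lt: "cmod (\<psi> z) < 1" if "cmod z < 1" for z
    unfolding \<psi>_def o_def using that lt b by (intro Moebius_function_norm_lt_1) auto
  have \<psi>0: "\<psi> 0 = 0"
    by (simp add: \<psi>_def b_def Moebius_function_eq_zero)
  have cb: "cnj b * b = of_real ((cmod b)\<^sup>2)"
    using complex_norm_square[of b] by (simp add: mult.commute)
  have nz: "1 - cnj b * b \<noteq> 0"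
    using b2 unfolding cb by (metis less_irrefl of_real_1 of_real_eq_iff right_minus_eq)
  have dh: "(h has_field_derivative deriv h 0) (at 0)"
    using h by (intro holomorphic_derivI[of h "ball 0 1"]) auto
  have "((\<lambda>z. (h z - b) / (1 - cnj b * h z)) has_field_derivative
          deriv h 0 / (1 - cnj b * b)) (at 0)"
    using nz by (auto intro!: derivative_eq_intros dh simp: b_def)
  hence "deriv \<psi> 0 = deriv h 0 / (1 - cnj b * b)"
    by (intro DERIV_imp_deriv) (simp add: \<psi>_def o_def Moebius_function_simple)
  also have "1 - cnj b * b = of_real (1 - (cmod b)\<^sup>2)"
    unfolding cb by simp
  finally have "cmod (deriv \<psi> 0) = cmod (deriv h 0) / (1 - (cmod b)\<^sup>2)"
    using b2 by (simp add: norm_divide del: of_real_diff)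
  moreover have "cmod (deriv \<psi> 0) \<le> 1"
    by (rule Schwarz_Lemma(2)[OF hol \<psi>0 \<psi>_lt, of 0]) auto
  ultimately show ?thesis
    using b2 by (simp add: b_def divide_le_eq)
qed

lemma fps_expansion_eq_if_eq_on_unit_disc:
  fixes f g :: "complex \<Rightarrow> complex"
  assumes F: "f has_fps_expansion F" and G: "g has_fps_expansion G"
    and eq: "\<And>z. z \<in> unit_disc \<Longrightarrow> f z = g z"
  shows "F = G"
proof -
  have "eventually (\<lambda>z. z \<in> unit_disc) (nhds (0::complex))"
    by (intro eventually_nhds_in_open) auto
  hence "eventually (\<lambda>z. f z = g z) (nhds 0)"
    by eventually_elim (rule eq)
  hence "g has_fps_expansion F"
    using has_fps_expansion_cong[of f g F F] F by simp
  thus ?thesis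
    using G by (rule fps_expansion_unique_complex)
qed

text \<open>
  Schwarz-Pick applies to \<open>\<omega>(z)/z\<close>, whose value and derivative at the origin are \<open>c\<^sub>1\<close> and
  \<open>c\<^sub>2\<close>. It maps into the open disc unless \<open>\<omega>\<close> is a rotation, and then \<open>c\<^sub>2 = 0\<close>.
\<close>

lemma schwarz_function_second_coeff:
  assumes hol: "\<omega> holomorphic_on ball 0 1"
    and lt: "\<And>z. cmod z < 1 \<Longrightarrow> cmod (\<omega> z) < 1"
    and zero: "\<omega> 0 = 0"
    and W: "\<omega> has_fps_expansion W"
  shows "cmod (fps_nth W 2) \<le> 1 - (cmod (fps_nth W 1))\<^sup>2"
proof (cases "\<exists>\<alpha>. (\<forall>z. cmod z < 1 \<longrightarrow> \<omega> z = \<alpha> * z) \<and> cmod \<alpha> = 1")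
  case True
  then obtain \<alpha> where \<alpha>: "\<And>z. cmod z < 1 \<Longrightarrow> \<omega> z = \<alpha> * z" "cmod \<alpha> = 1"
    by blast
  have "(\<lambda>z. \<alpha> * z) has_fps_expansion fps_const \<alpha> * fps_X"
    by (intro fps_expansion_intros)
  hence "W = fps_const \<alpha> * fps_X"
    by (rule fps_expansion_eq_if_eq_on_unit_disc[OF W]) (use \<alpha> in auto)
  thus ?thesis
    using \<alpha>(2) by simp
next
  case False
  obtain h where h: "h holomorphic_on ball 0 1" "\<And>z. cmod z < 1 \<Longrightarrow> \<omega> z = z * h z"
      "deriv \<omega> 0 = h 0"
    using Schwarz3[OF hol zero] by metis
  have h_lt: "cmod (h z) < 1" if z: "cmod z < 1" for z
  proof (cases "z = 0")
    case True
    have "cmod (deriv \<omega> 0) \<le> 1"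
      by (rule Schwarz_Lemma(2)[OF hol zero lt, of 0]) auto
    moreover have "cmod (deriv \<omega> 0) \<noteq> 1"
      using Schwarz_Lemma(3)[OF hol zero lt, of 0] False by auto
    ultimately show ?thesis
      using True h(3) by simp
  next
    case nz: False
    have "cmod (\<omega> z) \<le> cmod z"
      by (rule Schwarz_Lemma(1)[OF hol zero lt z])
    moreover have "cmod (\<omega> z) \<noteq> cmod z"
      using Schwarz_Lemma(3)[OF hol zero lt, of 0] False z nz by auto
    ultimately show ?thesis
      using h(2)[OF z] nz by (simp add: norm_mult)
  qed
  define H where "H = fps_expansion h 0"
  have H: "h has_fps_expansion H"
    unfolding H_def by (rule has_fps_expansion_fps_expansion[OF _ _ h(1)]) auto
  have "(\<lambda>z. z * h z) has_fps_expansion fps_X * H"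
    by (intro fps_expansion_intros H)
  hence "W = fps_X * H"
    by (rule fps_expansion_eq_if_eq_on_unit_disc[OF W]) (use h(2) in auto)
  hence "fps_nth W 1 = h 0" "fps_nth W 2 = deriv h 0"
    using fps_nth_fps_expansion[OF H, of 0] fps_nth_fps_expansion[OF H, of 1]
    by (simp_all add: fps_X_mult_nth)
  thus ?thesis
    using schwarz_pick_at_zero[OF h(1) h_lt] by simp
qed

text \<open>
  With \<open>x = |c\<^sub>1|\<^sup>2 \<in> [0, 1]\<close> the left-hand side is at most \<open>(1 - x) + |\<mu>| x\<close>, a convex combination
  of \<open>1\<close> and \<open>|\<mu>|\<close>.
\<close>

lemma schwarz_function_fekete_szego:
  assumes "\<omega> holomorphic_on ball 0 1"
    and "\<And>z. cmod z < 1 \<Longrightarrow> cmod (\<omega> z) < 1"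
    and "\<omega> 0 = 0"
    and "\<omega> has_fps_expansion W"
  shows "cmod (fps_nth W 2 - \<mu> * (fps_nth W 1)\<^sup>2) \<le> max 1 (cmod \<mu>)"
proof -
  define x where "x = (cmod (fps_nth W 1))\<^sup>2"
  have c2: "cmod (fps_nth W 2) \<le> 1 - x"
    using schwarz_function_second_coeff[OF assms] by (simp add: x_def)
  have x: "0 \<le> x" "x \<le> 1"
    using c2 norm_ge_zero[of "fps_nth W 2"] by (simp add: x_def, linarith)
  have "cmod (fps_nth W 2 - \<mu> * (fps_nth W 1)\<^sup>2) \<le> (1 - x) + cmod \<mu> * x"
    using norm_triangle_ineq4[of "fps_nth W 2" "\<mu> * (fps_nth W 1)\<^sup>2"] c2
    by (simp add: norm_mult norm_power x_def)
  also have "\<dots> \<le> (1 - x) * max 1 (cmod \<mu>) + max 1 (cmod \<mu>) * x"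
    using x mult_left_mono[of 1 "max 1 (cmod \<mu>)" "1 - x"]
      mult_right_mono[of "cmod \<mu>" "max 1 (cmod \<mu>)" x] by simp
  also have "\<dots> = max 1 (cmod \<mu>)"
    by (simp add: algebra_simps)
  finally show ?thesis .
qed

section \<open>The Fekete-Szego functional in terms of the Schwarz function\<close>

lemma normalized_expansion_has_fps_expansion:
  assumes "normalized_expansion f a"
  shows "f has_fps_expansion Abs_fps (\<lambda>n. if n = 0 then 0 else if n = 1 then 1 else a n)"
    (is "f has_fps_expansion ?F")
proof (rule has_fps_expansionI)
  have sums: "(\<lambda>n. fps_nth ?F n * z ^ n) sums f z" if "z \<in> unit_disc" for z
  proof -
    have "(\<lambda>n. fps_nth ?F (n + 2) * z ^ (n + 2)) sums (f z - z)"
      using assms that by (simp add: normalized_expansion_def)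
    thus ?thesis
      by (subst (asm) sums_iff_shift) (simp add: numeral_2_eq_2)
  qed
  have "eventually (\<lambda>z. z \<in> unit_disc) (nhds (0::complex))"
    by (intro eventually_nhds_in_open) auto
  thus "eventually (\<lambda>z. (\<lambda>n. fps_nth ?F n * z ^ n) sums f z) (nhds 0)"
    by eventually_elim (rule sums)
qed

lemma normalized_expansion_at_zero:
  assumes "normalized_expansion f a"
  shows "f 0 = 0"
  using has_fps_expansion_imp_0_eq_fps_nth_0[OF normalized_expansion_has_fps_expansion[OF assms]]
  by simp

text \<open>
  In \<open>z f' = f (1 + \<omega>)\<^sup>\<lambda>\<close>, the coefficients of \<open>z\<^sup>2\<close> and \<open>z\<^sup>3\<close> give \<open>a\<^sub>2 = p\<^sub>1\<close> and
  \<open>2 a\<^sub>3 = p\<^sub>2 + p\<^sub>1\<^sup>2\<close>, where \<open>p\<^sub>1 = \<lambda> c\<^sub>1\<close> and \<open>p\<^sub>2 = \<lambda> c\<^sub>2 + \<lambda> (\<lambda> - 1)/2 c\<^sub>1\<^sup>2\<close> are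
  the binomial coefficients of \<open>(1 + \<omega>)\<^sup>\<lambda>\<close>. Univalence enters through \<open>f z \<noteq> 0\<close> for \<open>z \<noteq> 0\<close>,
  which turns the quotient into this product.
\<close>

lemma fekete_szego_functional:
  fixes l :: real and \<delta> :: complex
  assumes inj: "inj_on f unit_disc"
    and a: "normalized_expansion f a"
    and W: "\<omega> has_fps_expansion W" and zero: "\<omega> 0 = 0"
    and eq: "\<And>z. z \<in> unit_disc \<Longrightarrow>
               starlike_quotient f z = (1 + \<omega> z) powr complex_of_real l"
  shows "a 3 - \<delta> * (a 2)\<^sup>2 =
           l / 2 * (fps_nth W 2 - (2 * l * \<delta> - (3 * l - 1) / 2) * (fps_nth W 1)\<^sup>2)"
proof -
  define F where "F = Abs_fps (\<lambda>n. if n = 0 then 0 else if n = 1 then 1 else a n)"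
  have F: "f has_fps_expansion F"
    unfolding F_def by (rule normalized_expansion_has_fps_expansion[OF a])
  have f0: "f 0 = 0"
    by (rule normalized_expansion_at_zero[OF a])
  have W0: "fps_nth W 0 = 0"
    using has_fps_expansion_imp_0_eq_fps_nth_0[OF W] zero by simp
  define P where "P = fps_binomial (complex_of_real l) oo W"
  have P: "(\<lambda>z. (1 + \<omega> z) powr complex_of_real l) has_fps_expansion P"
    using has_fps_expansion_compose[OF has_fps_expansion_binomial_complex W W0]
    by (simp add: o_def P_def)
  have "z * deriv f z = f z * (1 + \<omega> z) powr complex_of_real l" if z: "z \<in> unit_disc" for z
  proof (cases "z = 0")
    case False
    hence "f z \<noteq> 0"
      using inj_onD[OF inj, of z 0] z f0 by auto
    thus ?thesis
      using eq[OF z] False by (simp add: starlike_quotient_def field_simps)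
  qed (simp add: f0)
  moreover have "(\<lambda>z. z * deriv f z) has_fps_expansion fps_X * fps_deriv F"
    by (intro fps_expansion_intros F)
  moreover have "(\<lambda>z. f z * (1 + \<omega> z) powr complex_of_real l) has_fps_expansion F * P"
    by (intro has_fps_expansion_mult F P)
  ultimately have FP: "fps_X * fps_deriv F = F * P"
    by (intro fps_expansion_eq_if_eq_on_unit_disc)
  have P0: "fps_nth P 0 = 1"
    by (simp add: P_def)
  have P1: "fps_nth P 1 = l * fps_nth W 1"
    using W0 by (simp add: P_def fps_compose_nth fps_binomial_nth)
  have "(fps_nth (W ^ 2) 2) = (fps_nth W 1)\<^sup>2"
    using W0 by (simp add: power2_eq_square fps_mult_nth numeral_2_eq_2)
  moreover have "complex_of_real l gchoose 2 = l * (l - 1) / 2"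
    by (simp add: gbinomial_prod_rev numeral_2_eq_2)
  ultimately have P2: "fps_nth P 2 = l * fps_nth W 2 + l * (l - 1) / 2 * (fps_nth W 1)\<^sup>2"
    using W0 by (simp add: P_def fps_compose_nth fps_binomial_nth numeral_2_eq_2)
  have "fps_nth (fps_X * fps_deriv F) 2 = fps_nth (F * P) 2"
    by (simp add: FP)
  hence a2: "a 2 = fps_nth P 1"
    using P0 by (simp add: fps_X_mult_nth fps_mult_nth F_def numeral_2_eq_2 algebra_simps)
  have "fps_nth (fps_X * fps_deriv F) 3 = fps_nth (F * P) 3"
    by (simp add: FP)
  hence a3: "2 * a 3 = fps_nth P 2 + a 2 * fps_nth P 1"
    using P0 by (simp add: fps_X_mult_nth fps_mult_nth F_def numeral_2_eq_2 numeral_3_eq_3 algebra_simps)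
  hence "a 3 = (fps_nth P 2 + a 2 * fps_nth P 1) / 2"
    by (simp add: field_simps)
  thus ?thesis
    unfolding a2 P1 P2 by (simp add: field_simps power2_eq_square)
qed

section \<open>Univalence of starlike functions\<close>

text \<open>
  Along the segment from \<open>a\<close> to \<open>b\<close>, the real part of \<open>f / (b - a)\<close> is strictly increasing.
\<close>

lemma inj_on_if_Re_deriv_pos:
  fixes f :: "complex \<Rightarrow> complex"
  assumes S: "convex S"
    and der: "\<And>z. z \<in> S \<Longrightarrow> (f has_field_derivative f' z) (at z)"
    and pos: "\<And>z. z \<in> S \<Longrightarrow> Re (f' z) > 0"
  shows "inj_on f S"
proof (rule inj_onI, rule ccontr)
  fix a b assume ab: "a \<in> S" "b \<in> S" "f a = f b" "a \<noteq> b"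
  define \<gamma> where "\<gamma> t = a + complex_of_real t * (b - a)" for t
  define \<phi> where "\<phi> t = Re (f (\<gamma> t) / (b - a))" for t
  have "\<phi> 0 < \<phi> 1"
  proof (rule DERIV_pos_imp_increasing[of 0 1 \<phi>])
    fix t :: real assume t: "0 \<le> t" "t \<le> 1"
    have "\<gamma> t = (1 - t) *\<^sub>R a + t *\<^sub>R b"
      by (simp add: \<gamma>_def scaleR_conv_of_real algebra_simps)
    hence \<gamma>: "\<gamma> t \<in> S"
      using convexD_alt[OF S ab(1,2) t] by simp
    have "(\<gamma> has_vector_derivative (b - a)) (at t)"
      unfolding \<gamma>_def by (auto intro!: derivative_eq_intros)
    hence "((f \<circ> \<gamma>) has_vector_derivative (b - a) * f' (\<gamma> t)) (at t)"
      using der[OF \<gamma>] by (rule field_vector_diff_chain_at)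
    hence "((\<lambda>s. f (\<gamma> s) / (b - a)) has_vector_derivative (b - a) * f' (\<gamma> t) / (b - a)) (at t)"
      unfolding o_def by (rule has_vector_derivative_divide)
    hence "((\<lambda>s. f (\<gamma> s) / (b - a)) has_vector_derivative f' (\<gamma> t)) (at t)"
      using ab(4) by simp
    hence "(\<phi> has_real_derivative Re (f' (\<gamma> t))) (at t)"
      unfolding \<phi>_def has_real_derivative_iff_has_vector_derivative
      by (rule bounded_linear.has_vector_derivative[OF bounded_linear_Re])
    thus "\<exists>y. (\<phi> has_real_derivative y) (at t) \<and> y > 0"
      using pos[OF \<gamma>] by blast
  qed simp
  thus False
    using ab(3) by (simp add: \<phi>_def \<gamma>_def)
qed

text \<open>
  For \<open>f(z) = z exp (g z)\<close> the hypothesis reads \<open>Re (z f'/f) > 0\<close>. The map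
  \<open>F(w) = w + g(exp w)\<close> is injective on the left half-plane and satisfies
  \<open>F(w + 2 \<pi> i n) = F(w) + 2 \<pi> i n\<close>, so an equality \<open>exp (F u) = exp (F v)\<close> descends to
  \<open>exp u = exp v\<close>.
\<close>

lemma starlike_imp_univalent:
  assumes der: "\<And>z. z \<in> unit_disc \<Longrightarrow> (g has_field_derivative g' z) (at z)"
    and pos: "\<And>z. z \<in> unit_disc \<Longrightarrow> Re (1 + z * g' z) > 0"
  shows "inj_on (\<lambda>z. z * exp (g z)) unit_disc"
proof -
  define F where "F w = w + g (exp w)" for w
  have exp_in: "exp w \<in> unit_disc" if "Re w < 0" for w :: complex
    using that by simp
  have inj: "inj_on F {w. Re w < 0}"
  proof (rule inj_on_if_Re_deriv_pos)
    fix w :: complex assume w: "w \<in> {w. Re w < 0}"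
    show "(F has_field_derivative (1 + exp w * g' (exp w))) (at w)"
      unfolding F_def using exp_in w
      by (auto intro!: derivative_eq_intros DERIV_chain2[OF der])
    show "Re (1 + exp w * g' (exp w)) > 0"
      using exp_in w by (intro pos) auto
  qed (rule convex_halfspace_Re_lt)
  show ?thesis
  proof (rule inj_onI)
    fix x y assume xy: "x \<in> unit_disc" "y \<in> unit_disc" "x * exp (g x) = y * exp (g y)"
    show "x = y"
    proof (cases "x = 0 \<or> y = 0")
      case False
      define u v where "u = Ln x" and "v = Ln y"
      have uv: "exp u = x" "exp v = y"
        using False by (auto simp: u_def v_def)
      have neg: "Re u < 0" "Re v < 0"
        using xy(1,2) False by (auto simp: u_def v_def)
      have "exp (F u) = exp (F v)"
        using xy(3) by (simp add: F_def exp_add uv)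
      then obtain n :: int where n: "F u = F v + (of_int (2 * n) * pi) * \<i>"
        by (auto simp: exp_eq)
      define v' where "v' = v + (of_int (2 * n) * pi) * \<i>"
      have v': "exp v' = exp v"
        unfolding exp_eq v'_def by blast
      have "F u = F v'"
        using n v' by (simp add: F_def v'_def)
      moreover have "Re v' < 0"
        using neg by (simp add: v'_def)
      ultimately have "u = v'"
        using inj_onD[OF inj] neg by blast
      thus "x = y"
        using v' uv by simp
    qed (use xy in auto)
  qed
qed

section \<open>Members of the class with a prescribed Schwarz function\<close>

lemma Re_powr_pos:
  assumes z: "Re z > 0" and l: "\<bar>l\<bar> \<le> 1"
  shows "Re (z powr complex_of_real l) > 0"
proof -
  have nz: "z \<noteq> 0"
    using z by auto
  have "\<bar>l * Im (Ln z)\<bar> \<le> \<bar>Im (Ln z)\<bar>"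
    using mult_right_mono[OF l, of "\<bar>Im (Ln z)\<bar>"] by (simp add: abs_mult)
  also have "\<dots> < pi / 2"
    using Re_Ln_pos_lt[OF nz] z by simp
  finally have "cos (l * Im (Ln z)) > 0"
    by (intro cos_gt_zero_pi) auto
  thus ?thesis
    using nz by (simp add: powr_def Re_exp)
qed

lemma exists_normalized_expansion:
  assumes hol: "f holomorphic_on unit_disc"
    and "f 0 = 0" and "deriv f 0 = 1"
  shows "\<exists>a. normalized_expansion f a"
proof
  define a where "a n = (deriv ^^ n) f 0 / fact n" for n
  have "(\<lambda>n. a (n + 2) * z ^ (n + 2)) sums (f z - z)" if "z \<in> unit_disc" for z
  proof -
    have "(\<lambda>n. a n * z ^ n) sums f z"
      using holomorphic_power_series[OF hol that] by (simp add: a_def)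
    thus ?thesis
      by (subst sums_iff_shift) (simp add: numeral_2_eq_2 a_def assms)
  qed
  thus "normalized_expansion f a"
    by (simp add: normalized_expansion_def)
qed

text \<open>
  With \<open>p = (1 + \<omega>)\<^sup>\<lambda>\<close>, the differential equation \<open>z f'/f = p\<close> is solved by \<open>f(z) = z exp (g z)\<close>
  for a primitive \<open>g\<close> of \<open>(p - 1)/z\<close>, normalized by \<open>g 0 = 0\<close> so that \<open>f' 0 = 1\<close>.
\<close>

lemma exists_ST_ss_of_schwarz_function:
  assumes l: "0 < l" "l \<le> 1"
    and hol: "\<omega> holomorphic_on unit_disc"
    and lt: "\<And>z. z \<in> unit_disc \<Longrightarrow> \<omega> z \<in> unit_disc"
    and zero: "\<omega> 0 = 0"
  obtains f a where "f \<in> class_ST_ss l" "normalized_expansion f a"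
    "\<And>z. z \<in> unit_disc \<Longrightarrow> starlike_quotient f z = (1 + \<omega> z) powr complex_of_real l"
proof -
  define p where "p z = (1 + \<omega> z) powr complex_of_real l" for z
  have Re_pos: "Re (1 + \<omega> z) > 0" if "z \<in> unit_disc" for z
    using lt[OF that] abs_Re_le_cmod[of "\<omega> z"] by simp
  have p_hol: "p holomorphic_on unit_disc"
    unfolding p_def using Re_pos
    by (intro holomorphic_intros hol) (fastforce simp: complex_nonpos_Reals_iff)
  have p0: "p 0 = 1"
    by (simp add: p_def zero)
  have p_pos: "Re (p z) > 0" if "z \<in> unit_disc" for z
    unfolding p_def using Re_pos[OF that] l by (intro Re_powr_pos) auto
  define q where "q z = (if z = 0 then deriv p 0 else (p z - p 0) / (z - 0))" for z
  have "q holomorphic_on unit_disc"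
    unfolding q_def by (rule pole_lemma_open[OF p_hol]) auto
  then obtain g\<^sub>0 where "\<And>z. z \<in> unit_disc \<Longrightarrow> (g\<^sub>0 has_field_derivative q z) (at z within unit_disc)"
    using holomorphic_convex_primitive'[of unit_disc q] by auto
  hence g\<^sub>0: "(g\<^sub>0 has_field_derivative q z) (at z)" if "z \<in> unit_disc" for z
    using that at_within_open[of z unit_disc] by (metis open_ball)
  define g where "g z = g\<^sub>0 z - g\<^sub>0 0" for z
  have g: "(g has_field_derivative q z) (at z)" if "z \<in> unit_disc" for z
    unfolding g_def using g\<^sub>0[OF that] by (auto intro!: derivative_eq_intros)
  have pq: "1 + z * q z = p z" for z
    by (simp add: q_def p0)
  define f where "f z = z * exp (g z)" for z
  have der_f: "(f has_field_derivative exp (g z) * p z) (at z)" if "z \<in> unit_disc" for z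
  proof -
    have "(f has_field_derivative exp (g z) * (1 + z * q z)) (at z)"
      unfolding f_def using that
      by (auto intro!: derivative_eq_intros g simp: algebra_simps)
    thus ?thesis
      by (simp add: pq)
  qed
  have f_hol: "f holomorphic_on unit_disc"
    using der_f by (subst holomorphic_on_open) blast+
  have f0: "f 0 = 0"
    by (simp add: f_def)
  have f'0: "deriv f 0 = 1"
    using DERIV_imp_deriv[OF der_f[of 0]] by (simp add: p0 g_def)
  obtain a where a: "normalized_expansion f a"
    using exists_normalized_expansion[OF f_hol f0 f'0] by blast
  have quot: "starlike_quotient f z = p z" if "z \<in> unit_disc" for z
    using DERIV_imp_deriv[OF der_f[OF that]]
    by (simp add: starlike_quotient_def p0 f_def)
  have inj: "inj_on f unit_disc"
    unfolding f_def
  proof (rule starlike_imp_univalent[OF g])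
    fix z :: complex assume "z \<in> unit_disc"
    thus "Re (1 + z * q z) > 0"
      unfolding pq by (rule p_pos)
  qed
  have "f \<in> class_ST"
    using f_hol a inj quot p_pos by (auto simp: class_ST_def class_A_def)
  moreover have "subordinate (starlike_quotient f) (\<lambda>z. (1 + z) powr complex_of_real l)"
    unfolding subordinate_def using hol lt zero quot by (intro exI[of _ \<omega>]) (auto simp: p_def)
  ultimately have "f \<in> class_ST_ss l"
    by (simp add: class_ST_ss_def)
  thus ?thesis
    using that a quot by (simp add: p_def)
qed

section \<open>The sharp Fekete-Szego inequality\<close>

lemma ST_ss_fekete_szego_bound:
  fixes l \<delta> :: real
  assumes l: "0 < l" and f: "f \<in> class_ST_ss l" and a: "normalized_expansion f a"
  shows "cmod (a 3 - complex_of_real \<delta> * (a 2)\<^sup>2) \<le> l / 2 * max 1 \<bar>2 * l * \<delta> - (3 * l - 1) / 2\<bar>"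
proof -
  define \<mu> where "\<mu> = 2 * l * \<delta> - (3 * l - 1) / 2"
  have inj: "inj_on f unit_disc"
    using f by (simp add: class_ST_ss_def class_ST_def)
  obtain \<omega> where \<omega>: "\<omega> holomorphic_on unit_disc" "\<omega> ` unit_disc \<subseteq> unit_disc" "\<omega> 0 = 0"
    "\<And>z. z \<in> unit_disc \<Longrightarrow> starlike_quotient f z = (1 + \<omega> z) powr complex_of_real l"
    using f by (auto simp: class_ST_ss_def subordinate_def)
  have lt: "cmod (\<omega> z) < 1" if "cmod z < 1" for z
    using \<omega>(2) that by (auto simp: image_subset_iff)
  define W where "W = fps_expansion \<omega> 0"
  have W: "\<omega> has_fps_expansion W"
    unfolding W_def by (rule has_fps_expansion_fps_expansion[OF _ _ \<omega>(1)]) auto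
  have "a 3 - complex_of_real \<delta> * (a 2)\<^sup>2 =
          l / 2 * (fps_nth W 2 - complex_of_real \<mu> * (fps_nth W 1)\<^sup>2)"
    using fekete_szego_functional[OF inj a W \<omega>(3,4), of \<delta>] by (simp add: \<mu>_def)
  hence "cmod (a 3 - complex_of_real \<delta> * (a 2)\<^sup>2) =
          l / 2 * cmod (fps_nth W 2 - complex_of_real \<mu> * (fps_nth W 1)\<^sup>2)"
    using l by (simp only: norm_mult norm_divide) simp
  also have "\<dots> \<le> l / 2 * max 1 (cmod (complex_of_real \<mu>))"
    using l by (intro mult_left_mono schwarz_function_fekete_szego[OF \<omega>(1) lt \<omega>(3) W]) auto
  finally show ?thesis
    by (simp add: \<mu>_def del: of_real_diff)
qed

text \<open>
  The Schwarz function \<open>z\<close> has \<open>(c\<^sub>1, c\<^sub>2) = (1, 0)\<close> and \<open>z\<^sup>2\<close> has \<open>(c\<^sub>1, c\<^sub>2) = (0, 1)\<close>; the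
  larger of \<open>1\<close> and \<open>|\<mu>|\<close> decides which of them is extremal.
\<close>

lemma ST_ss_fekete_szego_attained:
  fixes l \<delta> :: real
  assumes l: "0 < l" "l \<le> 1"
  obtains f a where "f \<in> class_ST_ss l" "normalized_expansion f a"
    "cmod (a 3 - complex_of_real \<delta> * (a 2)\<^sup>2) = l / 2 * max 1 \<bar>2 * l * \<delta> - (3 * l - 1) / 2\<bar>"
proof -
  define \<mu> where "\<mu> = 2 * l * \<delta> - (3 * l - 1) / 2"
  define k :: nat where "k = (if \<bar>\<mu>\<bar> \<le> 1 then 2 else 1)"
  have k: "k = 1 \<or> k = 2"
    by (simp add: k_def)
  have lt: "z ^ k \<in> unit_disc" if "z \<in> unit_disc" for z :: complex
    using that k by (auto simp: norm_power power_less_one_iff)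
  have hol: "(\<lambda>z::complex. z ^ k) holomorphic_on unit_disc"
    by (intro holomorphic_intros)
  have zero: "(0::complex) ^ k = 0"
    using k by auto
  obtain f a where f: "f \<in> class_ST_ss l" and a: "normalized_expansion f a"
    and quot: "\<And>z. z \<in> unit_disc \<Longrightarrow> starlike_quotient f z = (1 + z ^ k) powr complex_of_real l"
    using exists_ST_ss_of_schwarz_function[OF l hol lt zero] by metis
  have inj: "inj_on f unit_disc"
    using f by (simp add: class_ST_ss_def class_ST_def)
  have W: "(\<lambda>z::complex. z ^ k) has_fps_expansion fps_X ^ k"
    by (intro fps_expansion_intros)
  have "a 3 - complex_of_real \<delta> * (a 2)\<^sup>2 =
          l / 2 * (fps_nth (fps_X ^ k) 2 - complex_of_real \<mu> * (fps_nth (fps_X ^ k) 1)\<^sup>2)"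
    using fekete_szego_functional[OF inj a W zero quot, of \<delta>] by (simp add: \<mu>_def)
  hence "cmod (a 3 - complex_of_real \<delta> * (a 2)\<^sup>2) = l / 2 * max 1 \<bar>\<mu>\<bar>"
    using l by (cases "\<bar>\<mu>\<bar> \<le> 1") (simp_all only: norm_mult norm_divide k_def, simp_all)
  thus ?thesis
    using that f a by (simp add: \<mu>_def)
qed

theorem theorem5p4:
  fixes l \<delta> :: real
  assumes "0 < l" and "l \<le> 1"
  shows "let B = (if \<delta> < 3 * (l - 1) / (4 * l) then - (l\<^sup>2) * (\<delta> + (1 - 3 * l) / (4 * l))
                  else if \<delta> \<le> (1 + 3 * l) / (4 * l) then l / 2
                  else l\<^sup>2 * (\<delta> + (1 - 3 * l) / (4 * l)))
         in (\<forall>f\<in>class_ST_ss l. \<forall>a. normalized_expansion f a \<longrightarrow>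
               cmod (a 3 - complex_of_real \<delta> * (a 2)\<^sup>2) \<le> B) \<and>
            (\<forall>M<B. \<exists>f\<in>class_ST_ss l. \<exists>a. normalized_expansion f a \<and>
               cmod (a 3 - complex_of_real \<delta> * (a 2)\<^sup>2) > M)"
proof -
  define \<mu> where "\<mu> = 2 * l * \<delta> - (3 * l - 1) / 2"
  have lower: "\<delta> < 3 * (l - 1) / (4 * l) \<longleftrightarrow> \<mu> < -1"
    and upper: "\<delta> \<le> (1 + 3 * l) / (4 * l) \<longleftrightarrow> \<mu> \<le> 1"
    and scaled: "l\<^sup>2 * (\<delta> + (1 - 3 * l) / (4 * l)) = l / 2 * \<mu>"
    using assms(1) by (auto simp: \<mu>_def field_simps power2_eq_square)
  have B: "(if \<delta> < 3 * (l - 1) / (4 * l) then - (l\<^sup>2) * (\<delta> + (1 - 3 * l) / (4 * l))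
            else if \<delta> \<le> (1 + 3 * l) / (4 * l) then l / 2
            else l\<^sup>2 * (\<delta> + (1 - 3 * l) / (4 * l))) = l / 2 * max 1 \<bar>\<mu>\<bar>"
    unfolding lower upper mult_minus_left scaled by auto
  obtain f a where "f \<in> class_ST_ss l" "normalized_expansion f a"
    "cmod (a 3 - complex_of_real \<delta> * (a 2)\<^sup>2) = l / 2 * max 1 \<bar>\<mu>\<bar>"
    using ST_ss_fekete_szego_attained[OF assms] unfolding \<mu>_def by metis
  thus ?thesis
    unfolding Let_def B
    using ST_ss_fekete_szego_bound[OF assms(1)] unfolding \<mu>_def by metis
qed

end
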